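(* Let $n$ and $d$ be positive integers. For every $\delta\in[0,1]$ there exist a tropical holomorphic curve $f:\mathbb{R}\to\mathbb{TP}^n$ and a homogeneous tropical polynomial $P$ of degree $d$ such that $\delta(V_P,f)=\delta$.
   Context: $0_\circ=-\infty$, $1_\circ=0$, $a\oslash b=a-b$, so $1_\circ\oslash g=-g$. A tropical meromorphic function is a continuous piecewise linear $g:\mathbb{R}\to\mathbb{R}$ (finitely many affine pieces on each bounded interval); with $\omega_g(x)=\lim_{\varepsilon\to0^+}(g'(x+\varepsilon)-g'(x-\varepsilon))$, $x$ is a root if $\omega_g(x)>0$, a pole if $\omega_g(x)<0$, of multiplicity $\tau_g(x)=|\omega_g(x)|$. It is tropical entire if it has no poles. $N(r,g)=\frac12\sum_{|b|<r}\tau_g(b)(r-|b|)$ over the poles $b$ of $g$ in $(-r,r)$. $\mathbb{TP}^n$ is the quotient of $(\mathbb{R}\cup\{-\infty\})^{n+1}\setminus\{(-\infty,\dots,-\infty)\}$ by adding a common real constant to all coordinates. A tropical holomorphic curve is $f=[f_0:\cdots:f_n]:\mathbb{R}\to\mathbb{TP}^n$ with $f_0,\dots,f_n$ tropical entire functions having no root common to all of them (a reduced representation). $T_f(r)=\frac12(\|f(r)\|+\|f(-r)\|)$ with $\|f(x)\|=\max_i f_i(x)$. A homogeneous tropical polynomial of degree $d$ is $P(x,x_0,\dots,x_n)=\max_{\alpha}\{a_\alpha(x)+\alpha_0x_0+\cdots+\alpha_nx_n\}$, the maximum over a nonempty finite set of $\alpha\in\mathbb{R}_{\ge0}^{n+1}$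 with $\alpha_0+\cdots+\alpha_n=d$, with tropical meromorphic (e.g. constant) coefficients $a_\alpha$; $P\circ f$ is obtained by substituting $x_i=f_i(x)$. $V_P$ denotes the tropical hypersurface of $P$ and the defect is $$\delta(V_P,f)=1-\limsup_{r\to\infty}\frac{N\big(r,1_\circ\oslash(P\circ f)\big)}{d\,T_f(r)}.$$ *)

theory Defs
  imports "HOL-Analysis.Analysis"
begin

definition trop_meromorphic :: "(real \<Rightarrow> real) \<Rightarrow> bool" where
  "trop_meromorphic g \<longleftrightarrow> continuous_on UNIV g \<and>
     (\<forall>a b. a < b \<longrightarrow> (\<exists>\<D>. \<D> division_of {a..b} \<and>
        (\<forall>J\<in>\<D>. \<exists>m c. \<forall>x\<in>J. g x = m * x + c)))"

definition trop_omega :: "(real \<Rightarrow> real) \<Rightarrow> real \<Rightarrow> real" where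
  "trop_omega g x = Lim (at_right 0) (\<lambda>\<epsilon>. deriv g (x + \<epsilon>) - deriv g (x - \<epsilon>))"

definition trop_root :: "(real \<Rightarrow> real) \<Rightarrow> real \<Rightarrow> bool" where
  "trop_root g x \<longleftrightarrow> trop_omega g x > 0"

definition trop_pole :: "(real \<Rightarrow> real) \<Rightarrow> real \<Rightarrow> bool" where
  "trop_pole g x \<longleftrightarrow> trop_omega g x < 0"

definition trop_mult :: "(real \<Rightarrow> real) \<Rightarrow> real \<Rightarrow> real" where
  "trop_mult g x = \<bar>trop_omega g x\<bar>"

definition trop_entire :: "(real \<Rightarrow> real) \<Rightarrow> bool" where
  "trop_entire g \<longleftrightarrow> trop_meromorphic g \<and> (\<forall>x. \<not> trop_pole g x)"

definition trop_counting :: "real \<Rightarrow> (real \<Rightarrow> real) \<Rightarrow> real" where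
  "trop_counting r g = (\<Sum>b | \<bar>b\<bar> < r \<and> trop_pole g b. trop_mult g b * (r - \<bar>b\<bar>)) / 2"

text \<open>Coordinates are indexed by \<open>{..n}\<close>; tuples over \<open>\<real> \<union> {-\<infinity>}\<close> are
  extensional functions, so that each tuple has exactly one encoding.\<close>

definition trop_tuples :: "nat \<Rightarrow> (nat \<Rightarrow> ereal) set" where
  "trop_tuples n = ({..n} \<rightarrow>\<^sub>E {x. x \<noteq> \<infinity>}) - {\<lambda>i\<in>{..n}. -\<infinity>}"

definition TP_rel :: "nat \<Rightarrow> ((nat \<Rightarrow> ereal) \<times> (nat \<Rightarrow> ereal)) set" where
  "TP_rel n = {(x, y). x \<in> trop_tuples n \<and> y \<in> trop_tuples n \<and>
     (\<exists>c::real. \<forall>i\<le>n. y i = x i + ereal c)}"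

definition TP :: "nat \<Rightarrow> (nat \<Rightarrow> ereal) set set" where
  "TP n = trop_tuples n // TP_rel n"

definition TP_point :: "nat \<Rightarrow> (nat \<Rightarrow> real) \<Rightarrow> (nat \<Rightarrow> ereal) set" where
  "TP_point n x = TP_rel n `` {\<lambda>i\<in>{..n}. ereal (x i)}"

text \<open>The map \<open>F\<close> into projective space is a tropical holomorphic curve iff it has a
  reduced representation \<open>f\<close>.\<close>

definition reduced_representation ::
    "nat \<Rightarrow> (real \<Rightarrow> (nat \<Rightarrow> ereal) set) \<Rightarrow> (nat \<Rightarrow> real \<Rightarrow> real) \<Rightarrow> bool" where
  "reduced_representation n F f \<longleftrightarrow>
     F \<in> UNIV \<rightarrow> TP n \<and> (\<forall>x. F x = TP_point n (\<lambda>i. f i x)) \<and>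
     (\<forall>i\<le>n. trop_entire (f i)) \<and> (\<nexists>x. \<forall>i\<le>n. trop_root (f i) x)"

definition trop_norm :: "nat \<Rightarrow> (nat \<Rightarrow> real \<Rightarrow> real) \<Rightarrow> real \<Rightarrow> real" where
  "trop_norm n f x = (MAX i\<in>{..n}. f i x)"

definition trop_char :: "nat \<Rightarrow> (nat \<Rightarrow> real \<Rightarrow> real) \<Rightarrow> real \<Rightarrow> real" where
  "trop_char n f r = (trop_norm n f r + trop_norm n f (- r)) / 2"

text \<open>The exponents \<open>\<alpha>\<close> are nonnegative reals, not necessarily integers. The point
  \<open>y\<close> ranges over finite coordinates, which suffices because entire functions are real-valued.\<close>

definition hom_trop_poly :: "nat \<Rightarrow> nat \<Rightarrow> (real \<Rightarrow> (nat \<Rightarrow> real) \<Rightarrow> real) \<Rightarrow> bool" where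
  "hom_trop_poly n d P \<longleftrightarrow>
     (\<exists>S a. finite S \<and> S \<noteq> {} \<and> S \<subseteq> ({..n} \<rightarrow>\<^sub>E {0..}) \<and>
        (\<forall>\<alpha>\<in>S. (\<Sum>i\<le>n. \<alpha> i) = real d \<and> trop_meromorphic (a \<alpha>)) \<and>
        (\<forall>x y. P x y = (MAX \<alpha>\<in>S. a \<alpha> x + (\<Sum>i\<le>n. \<alpha> i * y i))))"

definition trop_comp ::
    "(real \<Rightarrow> (nat \<Rightarrow> real) \<Rightarrow> real) \<Rightarrow> (nat \<Rightarrow> real \<Rightarrow> real) \<Rightarrow> real \<Rightarrow> real" where
  "trop_comp P f x = P x (\<lambda>i. f i x)"

text \<open>The defect of the hypersurface of \<open>P\<close>, a polynomial of degree \<open>d\<close>, computed from a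
  reduced representation \<open>f\<close>. The tropical quotient of \<open>1\<^sub>\<circ> = 0\<close> by \<open>g\<close> is \<open>- g\<close>. The formula
  is meaningful only if \<open>trop_char n f r\<close> is nonzero for all large \<open>r\<close>; otherwise HOL's
  \<open>x / 0 = 0\<close> would intervene.\<close>

definition trop_defect ::
    "nat \<Rightarrow> nat \<Rightarrow> (real \<Rightarrow> (nat \<Rightarrow> real) \<Rightarrow> real) \<Rightarrow> (nat \<Rightarrow> real \<Rightarrow> real) \<Rightarrow> ereal" where
  "trop_defect n d P f = 1 - Limsup at_top
     (\<lambda>r. ereal (trop_counting r (\<lambda>x. - trop_comp P f x) / (real d * trop_char n f r)))"

end

theory Submission
  imports Defs
begin

text \<open>Take the monomial \<open>P = d x\<^sub>0\<close> and the curve with \<open>f\<^sub>0(x) = (1 - \<delta>)\<bar>x\<bar>\<close> and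
  \<open>f\<^sub>i(x) = \<bar>x - 1\<bar>\<close> for \<open>i \<ge> 1\<close>. The only root of \<open>P \<circ> f\<close> is \<open>0\<close>, so that the counting function
  is \<open>d (1 - \<delta>) r\<close>, whereas \<open>r \<le> T\<^sub>f(r) \<le> r + 1/2\<close>. Shifting the kink of \<open>f\<^sub>i\<close> to \<open>1\<close> keeps the
  representation reduced.\<close>

lemma trop_meromorphic_abs: "trop_meromorphic (\<lambda>x. c * \<bar>x - a\<bar>)"
  unfolding trop_meromorphic_def
proof (intro conjI allI impI)
  show "continuous_on UNIV (\<lambda>x. c * \<bar>x - a\<bar>)"
    by (intro continuous_intros)
next
  fix u v :: real
  assume "u < v"
  have right: "\<exists>m k. \<forall>x\<in>J. c * \<bar>x - a\<bar> = m * x + k" if "J \<subseteq> {a..}" for J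
    using that by (intro exI[of _ c] exI[of _ "- c * a"]) (auto simp: algebra_simps)
  have left: "\<exists>m k. \<forall>x\<in>J. c * \<bar>x - a\<bar> = m * x + k" if "J \<subseteq> {..a}" for J
    using that by (intro exI[of _ "- c"] exI[of _ "c * a"]) (auto simp: algebra_simps)
  show "\<exists>\<D>. \<D> division_of {u..v} \<and> (\<forall>J\<in>\<D>. \<exists>m k. \<forall>x\<in>J. c * \<bar>x - a\<bar> = m * x + k)"
  \<comment> \<open>Only a kink strictly inside the interval forces a cut at \<open>a\<close>;
    otherwise the whole interval lies on one side of it and is a single affine piece.\<close>
  proof (cases "u < a \<and> a < v")
    case True
    then have "{{u..a}, {a..v}} division_of {u..v}"
      by (auto simp: division_of_def interior_atLeastAtMost_real)
    then show ?thesis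
      using left[of "{u..a}"] right[of "{a..v}"] by (intro exI[of _ "{{u..a}, {a..v}}"]) simp
  next
    case False
    then have "{u..v} \<subseteq> {..a} \<or> {u..v} \<subseteq> {a..}"
      by auto
    then have "\<exists>m k. \<forall>x\<in>{u..v}. c * \<bar>x - a\<bar> = m * x + k"
      using left[of "{u..v}"] right[of "{u..v}"] by argo
    then show ?thesis
      using \<open>u < v\<close> division_of_self[of u v] by (intro exI[of _ "{{u..v}}"]) simp
  qed
qed

lemma deriv_mult_abs:
  fixes c a x :: real
  assumes "x \<noteq> a"
  shows "deriv (\<lambda>x. c * \<bar>x - a\<bar>) x = c * sgn (x - a)"
proof (rule DERIV_imp_deriv)
  \<comment> \<open>With \<open>s\<close> the sign of \<open>x - a\<close>, this linear function
    agrees with the given one on the open half-line bounded by \<open>a\<close> that contains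
    \<open>x\<close>.\<close>
  have "((\<lambda>x. c * (s * (x - a))) has_real_derivative c * s) (at x)" for s
    by (auto intro!: derivative_eq_intros)
  moreover have "open (if x < a then {..<a} else {a<..})" "x \<in> (if x < a then {..<a} else {a<..})"
    using assms by auto
  ultimately show "((\<lambda>x. c * \<bar>x - a\<bar>) has_real_derivative c * sgn (x - a)) (at x)"
    by (rule has_field_derivative_transform_within_open)
      (use assms in \<open>auto simp: sgn_real_def split: if_splits\<close>)
qed

text \<open>The slope jumps from \<open>- c\<close> to \<open>c\<close> at \<open>a\<close> and is
  constant on either side. The sign of \<open>c\<close> is left free, so that the result serves
  roots and poles alike.\<close>

lemma trop_omega_abs: "trop_omega (\<lambda>x. c * \<bar>x - a\<bar>) x = (if x = a then 2 * c else 0)"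
proof -
  let ?D = "deriv (\<lambda>x. c * \<bar>x - a\<bar>)"
  \<comment> \<open>For \<open>\<epsilon> < e\<close> neither sample point is \<open>a\<close>, and
    if \<open>x\<close> differs from \<open>a\<close> both lie on the same side of it as
    \<open>x\<close>. At \<open>x = a\<close> any positive bound would do.\<close>
  define e where "e = (if x = a then 1 else \<bar>x - a\<bar>)"
  have "e > 0"
    by (simp add: e_def)
  then have "\<forall>\<^sub>F \<epsilon> in at_right 0. ?D (x + \<epsilon>) - ?D (x - \<epsilon>) = (if x = a then 2 * c else 0)"
    unfolding eventually_at_right_field
  proof (intro exI conjI allI impI)
    fix \<epsilon> :: real
    assume "0 < \<epsilon>" "\<epsilon> < e"
    then show "?D (x + \<epsilon>) - ?D (x - \<epsilon>) = (if x = a then 2 * c else 0)"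
      by (subst (1 2) deriv_mult_abs) (auto simp: e_def sgn_real_def split: if_splits)
  qed
  then have "((\<lambda>\<epsilon>. ?D (x + \<epsilon>) - ?D (x - \<epsilon>)) \<longlongrightarrow> (if x = a then 2 * c else 0)) (at_right 0)"
    by (rule tendsto_eventually)
  then show ?thesis
    unfolding trop_omega_def by (intro tendsto_Lim) simp_all
qed

lemma trop_entire_abs: "c \<ge> 0 \<Longrightarrow> trop_entire (\<lambda>x. c * \<bar>x - a\<bar>)"
  by (simp add: trop_entire_def trop_pole_def trop_meromorphic_abs trop_omega_abs)

text \<open>The pole at 0 has multiplicity \<open>2 * c\<close>, and the factor 1/2 in the counting
  function turns this into \<open>c * r\<close>.\<close>

lemma trop_counting_neg_abs:
  assumes "c \<ge> 0" "r > 0"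
  shows "trop_counting r (\<lambda>x. - (c * \<bar>x\<bar>)) = c * r"
proof -
  have \<omega>: "trop_omega (\<lambda>x. - (c * \<bar>x\<bar>)) b = (if b = 0 then - 2 * c else 0)" for b
    using trop_omega_abs[of "- c" 0 b] by simp
  \<comment> \<open>For \<open>c = 0\<close>, which occurs when \<delta> = 1, there is no pole and
    the sum is empty; the value 0 still equals \<open>c * r\<close>.\<close>
  have "{b. \<bar>b\<bar> < r \<and> trop_pole (\<lambda>x. - (c * \<bar>x\<bar>)) b} = (if c = 0 then {} else {0})"
    using assms by (auto simp: trop_pole_def \<omega> split: if_splits)
  then show ?thesis
    using assms by (simp add: trop_counting_def trop_mult_def \<omega>)
qed

lemma TP_point_in_TP: "TP_point n x \<in> TP n"
proof -
  have "(\<lambda>i\<in>{..n}. ereal (x i)) \<in> trop_tuples n"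
    \<comment> \<open>Coordinate 0 is finite, which rules out the excluded tuple with all entries
      minus infinity.\<close>
    by (auto simp: trop_tuples_def fun_eq_iff intro!: exI[of _ 0])
  then show ?thesis
    unfolding TP_point_def TP_def by (rule quotientI)
qed

lemma reduced_representation_TP_point:
  assumes "\<And>i. i \<le> n \<Longrightarrow> trop_entire (f i)"
    and "\<And>x. \<exists>i\<le>n. \<not> trop_root (f i) x"
  shows "reduced_representation n (\<lambda>x. TP_point n (\<lambda>i. f i x)) f"
  using assms by (auto simp: reduced_representation_def TP_point_in_TP)

text \<open>The maximum runs over a single exponent vector, with \<open>d\<close> in position 0 and
  zeros elsewhere; its coefficient is the constant 0, the tropical unit.\<close>

lemma hom_trop_poly_monomial: "hom_trop_poly n d (\<lambda>x y. real d * y 0)"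
  unfolding hom_trop_poly_def
proof -
  let ?\<alpha> = "\<lambda>i\<in>{..n}. if i = 0 then real d else 0"
  have sum: "(\<Sum>i\<le>n. ?\<alpha> i * y i) = real d * y 0" for y
  proof -
    have "(\<Sum>i\<le>n. ?\<alpha> i * y i) = (\<Sum>i\<le>n. if i = 0 then real d * y i else 0)"
      by (rule sum.cong) auto
    then show ?thesis
      by simp
  qed
  have "?\<alpha> \<in> {..n} \<rightarrow>\<^sub>E {0..}"
    by auto
  moreover have "(\<Sum>i\<le>n. ?\<alpha> i) = real d"
    using sum[of "\<lambda>_. 1"] by simp
  moreover have "trop_meromorphic (\<lambda>_. 0)"
    using trop_meromorphic_abs[of 0 0] by simp
  ultimately show "\<exists>S a. finite S \<and> S \<noteq> {} \<and> S \<subseteq> ({..n} \<rightarrow>\<^sub>E {0..}) \<and>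
      (\<forall>\<alpha>\<in>S. (\<Sum>i\<le>n. \<alpha> i) = real d \<and> trop_meromorphic (a \<alpha>)) \<and>
      (\<forall>x y. real d * y 0 = (MAX \<alpha>\<in>S. a \<alpha> x + (\<Sum>i\<le>n. \<alpha> i * y i)))"
    by (intro exI[of _ "{?\<alpha>}"] exI[of _ "\<lambda>_ _. 0"]) (simp add: sum del: restrict_apply)
qed

theorem theorem4p9:
  fixes n d :: nat and \<delta> :: real
  assumes "n \<ge> 1" and "d \<ge> 1" and "\<delta> \<in> {0..1}"
  shows "\<exists>F f P. reduced_representation n F f \<and> hom_trop_poly n d P \<and>
           (\<forall>\<^sub>F r in at_top. trop_char n f r \<noteq> 0) \<and>
           trop_defect n d P f = ereal \<delta>"
proof -
  define f :: "nat \<Rightarrow> real \<Rightarrow> real" where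
    "f i = (if i = 0 then (\<lambda>x. (1 - \<delta>) * \<bar>x\<bar>) else (\<lambda>x. \<bar>x - 1\<bar>))" for i
  define P :: "real \<Rightarrow> (nat \<Rightarrow> real) \<Rightarrow> real" where "P = (\<lambda>x y. real d * y 0)"
  have rep: "reduced_representation n (\<lambda>x. TP_point n (\<lambda>i. f i x)) f"
  proof (rule reduced_representation_TP_point)
    show "trop_entire (f i)" if "i \<le> n" for i
      using trop_entire_abs[of "1 - \<delta>" 0] trop_entire_abs[of 1 1] assms(3) by (simp add: f_def)
    show "\<exists>i\<le>n. \<not> trop_root (f i) x" for x
    \<comment> \<open>The coordinate \<open>f 0\<close> can have a root only at 0, and there
      \<open>f 1\<close>, available because \<open>n \<ge> 1\<close>, is affine.\<close>
    proof (cases "x = 0")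
      case True
      then have "\<not> trop_root (f 1) x"
        using trop_omega_abs[of 1 1 x] by (simp add: trop_root_def f_def)
      then show ?thesis
        using assms(1) by blast
    next
      case False
      then have "\<not> trop_root (f 0) x"
        using trop_omega_abs[of "1 - \<delta>" 0 x] by (simp add: trop_root_def f_def)
      then show ?thesis
        by blast
    qed
  qed
  have poly: "hom_trop_poly n d P"
    unfolding P_def by (rule hom_trop_poly_monomial)
  have norm: "trop_norm n f x = max ((1 - \<delta>) * \<bar>x\<bar>) \<bar>x - 1\<bar>" for x
  proof -
    have "(\<lambda>i. f i x) ` {..n} = {(1 - \<delta>) * \<bar>x\<bar>, \<bar>x - 1\<bar>}"
      using assms(1) by (force simp: f_def image_iff)
    then show ?thesis
      by (simp add: trop_norm_def)
  qed
  \<comment> \<open>At \<open>- r\<close> the norm is exactly \<open>r + 1\<close>, attained by the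
    shifted coordinates; at \<open>r\<close> it lies between \<open>r - 1\<close> and
    \<open>r\<close>. Averaging gives both bounds.\<close>
  have char: "r \<le> trop_char n f r" "trop_char n f r \<le> r + 1 / 2" if "r \<ge> 1" for r
  proof -
    have "(1 - \<delta>) * r \<le> r"
      using assms(3) that by (simp add: mult_left_le_one_le)
    moreover from this have "(1 - \<delta>) * r \<le> 1 + r"
      by linarith
    ultimately have "max ((1 - \<delta>) * \<bar>r\<bar>) \<bar>r - 1\<bar> \<in> {r - 1..r}"
      "max ((1 - \<delta>) * \<bar>- r\<bar>) \<bar>- r - 1\<bar> = r + 1"
      using that by (simp_all add: max_def)
    then show "r \<le> trop_char n f r" "trop_char n f r \<le> r + 1 / 2"
      by (simp_all add: trop_char_def norm field_simps)
  qed
  have nz: "\<forall>\<^sub>F r in at_top. trop_char n f r \<noteq> 0"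
    using eventually_ge_at_top[of 1] by eventually_elim (use char in force)
  let ?q = "\<lambda>r. trop_counting r (\<lambda>x. - trop_comp P f x) / (real d * trop_char n f r)"
  have q: "?q r = (1 - \<delta>) * (r / trop_char n f r)" if "r \<ge> 1" for r
  proof -
    have "trop_counting r (\<lambda>x. - trop_comp P f x) = (real d * (1 - \<delta>)) * r"
      using trop_counting_neg_abs[of "real d * (1 - \<delta>)" r] assms(3) that
      by (simp add: trop_comp_def P_def f_def mult.assoc)
    then show ?thesis
      using assms(2) by simp
  qed
  \<comment> \<open>The upper bound 1 comes from \<open>r \<le> trop_char n f r\<close>. The lower
    one comes from \<open>trop_char n f r \<le> r + 1 / 2\<close>, since
    \<open>(1 - 1 / r) * (r + 1 / 2)\<close> is at most \<open>r\<close>.\<close>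
  have "((\<lambda>r. r / trop_char n f r) \<longlongrightarrow> 1) at_top"
  proof (rule tendsto_sandwich)
    show "\<forall>\<^sub>F r in at_top. 1 - 1 / r \<le> r / trop_char n f r"
      using eventually_ge_at_top[of 1]
    proof eventually_elim
      case (elim r)
      then have "1 - 1 / r \<le> r / (r + 1 / 2)"
        by (simp add: field_simps)
      also have "\<dots> \<le> r / trop_char n f r"
        using elim char[of r] by (intro divide_left_mono) auto
      finally show ?case .
    qed
    show "\<forall>\<^sub>F r in at_top. r / trop_char n f r \<le> 1"
      using eventually_ge_at_top[of 1] by eventually_elim (use char in force)
    have "((\<lambda>r::real. 1 / r) \<longlongrightarrow> 0) at_top"
      unfolding inverse_eq_divide[symmetric] by (rule tendsto_inverse_0_at_top[OF filterlim_ident])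
    from tendsto_diff[OF tendsto_const[of 1] this]
    show "((\<lambda>r::real. 1 - 1 / r) \<longlongrightarrow> 1) at_top"
      by simp
  qed simp
  from tendsto_mult_left[OF this, of "1 - \<delta>"]
  have "((\<lambda>r. (1 - \<delta>) * (r / trop_char n f r)) \<longlongrightarrow> 1 - \<delta>) at_top"
    by simp
  moreover have "\<forall>\<^sub>F r in at_top. (1 - \<delta>) * (r / trop_char n f r) = ?q r"
    using eventually_ge_at_top[of 1] by eventually_elim (simp only: q)
  ultimately have "(?q \<longlongrightarrow> 1 - \<delta>) at_top"
    by (rule Lim_transform_eventually)
  \<comment> \<open>The quotient converges, so the upper limit in the defect is an ordinary
    limit.\<close>
  then have "Limsup at_top (\<lambda>r. ereal (?q r)) = ereal (1 - \<delta>)"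
    by (intro lim_imp_Limsup tendsto_ereal) simp_all
  then have "trop_defect n d P f = ereal \<delta>"
    by (simp add: trop_defect_def one_ereal_def)
  with rep poly nz show ?thesis
    by blast
qed

end
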